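(* For every integer $d\geq 1$ there are constants $C_d>0$ and $p_0=p_0(d)$, depending only on $d$, such that the following holds for every prime $p\geq p_0$. Let $\Gamma\subset\mathbb{F}_p$ with $|\Gamma|=d$, let $\varepsilon>0$ be real, and let $B=B(\Gamma,\varepsilon)$ be the associated Bohr set. Then for any non-trivial multiplicative character $\chi$ modulo $p$, $$\left|\sum_{x\in B}\chi(x)\right|\leq C_d\,\sqrt p\,(\log p)^d.$$
   Context: $\mathbb{F}_p$ is the field with $p$ elements, $p$ prime. For real $\theta$, $\|\theta\|$ denotes the distance from $\theta$ to the nearest integer. For $\Gamma\subset\mathbb{F}_p$ and real $\varepsilon>0$, the Bohr set is $$B(\Gamma,\varepsilon)=\left\{x\in\mathbb{F}_p:\left\|\frac{xr}{p}\right\|\leq\varepsilon\text{ for each }r\in\Gamma\right\},$$ where $x,r$ are represented by integers (the value of $\|xr/p\|$ does not depend on the representatives). A non-trivial multiplicative character modulo $p$ is a non-constant homomorphism $\chi:\mathbb{F}_p^\times\to\mathbb{C}^\times$, extended by $\chi(0)=0$. The paper writes the conclusion as $\ll_d$, where $X\ll_d Y$ means that $X\leq cY$ for a constant $c$ depending only on $d$, once $p$ is sufficiently large. *)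

theory Defs
  imports
    "HOL-Analysis.Analysis"
    "HOL-Algebra.Algebraic_Closure_Type"
    "HOL-Number_Theory.Residues"
begin

text \<open>
  The field with \<open>p\<close> elements is \<^term>\<open>residue_ring (int p)\<close>, whose carrier is the set of
  integers \<open>0, \<dots>, p - 1\<close>.
\<close>

definition dist_int :: "real \<Rightarrow> real" where
  "dist_int \<theta> = infdist \<theta> \<int>"

lemma dist_int_eq_round: "dist_int \<theta> = \<bar>\<theta> - of_int (round \<theta>)\<bar>"
proof (rule antisym)
  show "dist_int \<theta> \<le> \<bar>\<theta> - of_int (round \<theta>)\<bar>"
    unfolding dist_int_def by (rule infdist_le2[of "of_int (round \<theta>)"]) (auto simp: dist_real_def)
  have "(\<int> :: real set) \<noteq> {}" by (auto intro: Ints_0)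
  moreover have "\<bar>\<theta> - of_int (round \<theta>)\<bar> \<le> dist \<theta> z" if "z \<in> \<int>" for z
    using that round_diff_minimal[of \<theta>] by (auto simp: dist_real_def elim!: Ints_cases)
  ultimately show "\<bar>\<theta> - of_int (round \<theta>)\<bar> \<le> dist_int \<theta>"
    unfolding dist_int_def by (auto simp: infdist_def intro!: cINF_greatest)
qed

definition bohr_set :: "nat \<Rightarrow> int set \<Rightarrow> real \<Rightarrow> int set" where
  "bohr_set p \<Gamma> \<epsilon> =
     {x \<in> carrier (residue_ring (int p)). \<forall>r\<in>\<Gamma>. dist_int (of_int (x * r) / real p) \<le> \<epsilon>}"

text \<open>
  Values of \<open>chi\<close> outside \<open>{0..p - 1}\<close> are left unconstrained.
\<close>

definition nontrivial_mult_character :: "nat \<Rightarrow> (int \<Rightarrow> complex) \<Rightarrow> bool" where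
  "nontrivial_mult_character p chi \<longleftrightarrow>
     chi \<in> hom (units_of (residue_ring (int p))) (units_of (ring_of_type_algebra :: complex ring)) \<and>
     \<not> chi constant_on carrier (units_of (residue_ring (int p))) \<and>
     chi 0 = 0"

end

theory Submission
  imports Defs "HOL-Library.Real_Mod"
begin

text \<open>
  The indicator function of a Bohr set is a product over \<open>r \<in> \<Gamma>\<close> of \<open>f (x * r)\<close>, where \<open>f\<close> is the
  indicator function of an interval modulo \<open>p\<close> centred at \<open>0\<close>. Expanding each factor into its
  Fourier series turns the sum over the Bohr set into a combination of Gauss sums
  \<open>\<Sum>x. \<chi> x * e(a * x / p)\<close>, each of norm at most \<open>sqrt p\<close>; the coefficients have total size
  at most \<open>L ^ d\<close>, where \<open>L\<close> is the sum of the absolute values of the Fourier coefficients of \<open>f\<close>.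
  Since these are bounded by \<open>1 / h + 1 / (p - h)\<close>, one has \<open>L = O(log p)\<close>.
\<close>

section \<open>Additive characters\<close>

text \<open>Taking arbitrary integers as arguments makes additivity hold without reduction modulo
  \<open>p\<close>.\<close>

definition addchar :: "nat \<Rightarrow> int \<Rightarrow> complex" where
  "addchar p k = cis (2 * pi * (of_int k / of_nat p))"

lemma addchar_0 [simp]: "addchar p 0 = 1"
  by (simp add: addchar_def)

lemma addchar_add: "addchar p (j + k) = addchar p j * addchar p k"
  by (simp add: addchar_def cis_mult add_divide_distrib distrib_left)

lemma addchar_diff: "addchar p (j - k) = addchar p j * addchar p (- k)"
  using addchar_add[of p j "- k"] by simp

lemma norm_addchar [simp]: "norm (addchar p k) = 1"
  by (simp add: addchar_def)

lemma cnj_addchar: "cnj (addchar p k) = addchar p (- k)"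
  by (simp add: addchar_def cis_cnj)

lemma addchar_eq_1_iff:
  assumes "p > 0"
  shows "addchar p k = 1 \<longleftrightarrow> int p dvd k"
proof -
  have "2 * pi * (of_int k / of_nat p) = of_int n * (2 * pi) \<longleftrightarrow> k = int p * n" for n :: int
  proof -
    have "2 * pi * (of_int k / of_nat p) = of_int n * (2 * pi) \<longleftrightarrow> real_of_int k = of_int (int p * n)"
      using assms by (simp add: field_simps)
    then show ?thesis by (simp only: of_int_eq_iff)
  qed
  then show ?thesis
    by (simp add: addchar_def cis_eq_1_iff dvd_def)
qed

lemma addchar_mod:
  assumes "p > 0"
  shows "addchar p (k mod int p) = addchar p k"
proof -
  have "addchar p k = addchar p (int p * (k div int p)) * addchar p (k mod int p)"
    by (simp flip: addchar_add)
  moreover have "addchar p (int p * (k div int p)) = 1"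
    using assms by (simp add: addchar_eq_1_iff)
  ultimately show ?thesis by simp
qed

lemma addchar_mult_mod:
  assumes "p > 0"
  shows "addchar p (h * (k mod int p)) = addchar p (h * k)"
  by (metis addchar_mod[OF assms] mod_mult_right_eq)

text \<open>Multiplying by \<open>1 - addchar p k\<close> telescopes the sum; the product form also
  covers \<open>addchar p k = 1\<close>.\<close>

lemma addchar_geometric_sum:
  assumes "a \<le> b"
  shows "(1 - addchar p k) * (\<Sum>m\<in>{a..<b}. addchar p (m * k)) = addchar p (a * k) - addchar p (b * k)"
  using assms
proof (induction b rule: int_ge_induct)
  case (step b)
  have "{a..<b + 1} = insert b {a..<b}"
    using step.hyps by auto
  moreover have "addchar p ((b + 1) * k) = addchar p (b * k) * addchar p k"
    by (simp add: distrib_right addchar_add)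
  ultimately show ?case
    using step.IH by (simp only: sum.insert finite_atLeastLessThan_int) (simp add: distrib_left, simp add: algebra_simps)
qed simp

text \<open>Orthogonality: over a full period the two endpoint terms of the geometric sum
  cancel.\<close>

lemma sum_addchar:
  assumes "p > 0"
  shows "(\<Sum>h\<in>{0..<int p}. addchar p (h * k)) = (if int p dvd k then of_nat p else 0)"
proof (cases "int p dvd k")
  case True
  then have "addchar p (h * k) = 1" for h
    using assms by (simp add: addchar_eq_1_iff)
  then show ?thesis
    using True by simp
next
  case False
  have "addchar p (int p * k) = 1" and neq: "addchar p k \<noteq> 1"
    using assms False by (simp_all add: addchar_eq_1_iff)
  then have "(1 - addchar p k) * (\<Sum>h\<in>{0..<int p}. addchar p (h * k)) = 0"
    by (simp only: addchar_geometric_sum of_nat_0_le_iff) simp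
  then show ?thesis
    using neq False by auto
qed

text \<open>The telescoped sum is a difference of two points on the unit circle, so the bound is
  uniform in the interval.\<close>

lemma norm_addchar_interval_sum_le:
  "norm (1 - addchar p k) * norm (\<Sum>m\<in>{a..<b}. addchar p (m * k)) \<le> 2"
proof (cases "a \<le> b")
  case True
  then show ?thesis
    using norm_triangle_ineq4[of "addchar p (a * k)" "addchar p (b * k)"]
    by (simp add: addchar_geometric_sum flip: norm_mult)
qed simp

text \<open>Jordan's inequality: concavity puts the sine above its chord from \<open>0\<close> to
  \<open>pi / 2\<close>.\<close>

lemma sin_ge_chord:
  fixes x :: real
  assumes "0 \<le> x" "x \<le> pi / 2"
  shows "2 * x / pi \<le> sin x"
proof -
  have "concave_on {0..pi / 2} (sin :: real \<Rightarrow> real)"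
  proof (rule f''_le0_imp_concave[where f' = cos and f'' = "\<lambda>x. - sin x"])
    show "- sin x \<le> 0" if "x \<in> {0..pi / 2}" for x :: real
      using that by (auto intro!: sin_ge_zero)
  qed (auto intro!: derivative_eq_intros)
  then have "sin x \<ge> (sin (pi / 2) - sin 0) / (pi / 2 - 0) * (x - 0) + sin 0"
    by (rule concave_onD_Icc') (use assms in auto)
  then show ?thesis by simp
qed

text \<open>The left side is \<open>2 * sin (pi * h / p)\<close>; if \<open>h\<close> exceeds
  \<open>p / 2\<close>, reflecting it to \<open>p - h\<close> brings the angle into the range of
  Jordan's inequality.\<close>

lemma norm_one_minus_addchar:
  assumes "0 < h" "h < int p"
  shows "norm (1 - addchar p h) \<ge> 4 * min (of_int h) (real p - of_int h) / real p"
proof -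
  define u where "u = min (of_int h) (real p - of_int h) / real p"
  define t where "t = pi * (of_int h / real p)"
  have p: "real p > 0" and h: "real_of_int h < real p"
    using assms by linarith+
  have "sin (pi * u) = sin t"
  proof (cases "real_of_int h \<le> real p - of_int h")
    case False
    then have "pi * u = pi - t"
      using p by (simp add: u_def t_def field_simps)
    then show ?thesis by simp
  qed (simp add: u_def t_def)
  moreover have "2 * (pi * u) / pi \<le> sin (pi * u)"
    using p h assms by (intro sin_ge_chord) (auto simp: u_def field_simps min_def)
  ultimately have sin: "2 * u \<le> sin t" by simp
  have "addchar p h = cis (2 * t)"
    by (simp add: addchar_def t_def mult.assoc)
  then have "norm (1 - addchar p h) ^ 2 = (1 - cos (2 * t))\<^sup>2 + (sin (2 * t))\<^sup>2"
    by (simp add: cmod_power2)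
  also have "\<dots> = 2 - 2 * cos (2 * t)"
    using sin_cos_squared_add3[of "2 * t"] by (simp add: power2_eq_square algebra_simps)
  also have "\<dots> = (2 * sin t)\<^sup>2"
    by (simp add: cos_double_sin power2_eq_square)
  finally have "norm (1 - addchar p h) = \<bar>2 * sin t\<bar>"
    by (metis abs_norm_cancel power2_eq_iff abs_eq_iff)
  with sin show ?thesis
    by (simp add: u_def)
qed


section \<open>Finite Fourier analysis\<close>

text \<open>The factor \<open>1 / p\<close> is placed here, so that inversion carries none.\<close>

definition fourier_coeff :: "nat \<Rightarrow> (int \<Rightarrow> complex) \<Rightarrow> int \<Rightarrow> complex" where
  "fourier_coeff p f h = (\<Sum>m\<in>{0..<int p}. f m * addchar p (- (h * m))) / of_nat p"

text \<open>After swapping the sums, orthogonality in \<open>h\<close> leaves only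
  \<open>m = y mod int p\<close>.\<close>

lemma fourier_inversion:
  assumes p: "p > 0" and per: "f (y mod int p) = f y"
  shows "f y = (\<Sum>h\<in>{0..<int p}. fourier_coeff p f h * addchar p (h * y))"
proof -
  have dvd: "int p dvd y - m \<longleftrightarrow> m = y mod int p" if "m \<in> {0..<int p}" for m
    using that by (auto simp flip: mod_eq_dvd_iff)
  have "of_nat p * (\<Sum>h\<in>{0..<int p}. fourier_coeff p f h * addchar p (h * y))
      = (\<Sum>h\<in>{0..<int p}. (\<Sum>m\<in>{0..<int p}. f m * addchar p (- (h * m))) * addchar p (h * y))"
    using p by (simp add: fourier_coeff_def sum_distrib_left)
  also have "\<dots> = (\<Sum>h\<in>{0..<int p}. \<Sum>m\<in>{0..<int p}. f m * addchar p (h * (y - m)))"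
    by (simp add: sum_distrib_right sum_distrib_left right_diff_distrib addchar_diff mult_ac)
  also have "\<dots> = (\<Sum>m\<in>{0..<int p}. f m * (\<Sum>h\<in>{0..<int p}. addchar p (h * (y - m))))"
    by (subst sum.swap) (simp add: sum_distrib_left)
  also have "\<dots> = (\<Sum>m\<in>{0..<int p}. if m = y mod int p then f m * of_nat p else 0)"
    by (intro sum.cong) (simp_all add: sum_addchar[OF p] dvd)
  also have "\<dots> = f y * of_nat p"
    using p per by simp
  finally show ?thesis
    using p by simp
qed

text \<open>The squares expand into double sums, of which orthogonality leaves the diagonal. The
  transform is unnormalised here, whence the factor \<open>p\<close>.\<close>

lemma parseval:
  assumes p: "p > 0"
  shows "(\<Sum>b\<in>{0..<int p}. (norm (\<Sum>x\<in>{0..<int p}. f x * addchar p (b * x)))\<^sup>2)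
       = real p * (\<Sum>x\<in>{0..<int p}. (norm (f x))\<^sup>2)"
proof -
  have dvd: "int p dvd x - y \<longleftrightarrow> y = x" if "x \<in> {0..<int p}" "y \<in> {0..<int p}" for x y
    using that by (auto simp flip: mod_eq_dvd_iff)
  have "complex_of_real (\<Sum>b\<in>{0..<int p}. (norm (\<Sum>x\<in>{0..<int p}. f x * addchar p (b * x)))\<^sup>2)
     = (\<Sum>b\<in>{0..<int p}. \<Sum>x\<in>{0..<int p}. \<Sum>y\<in>{0..<int p}. f x * cnj (f y) * addchar p (b * (x - y)))"
    by (simp add: complex_norm_square cnj_addchar sum_product right_diff_distrib
        addchar_diff mult_ac del: of_real_power)
  also have "\<dots> = (\<Sum>x\<in>{0..<int p}. \<Sum>b\<in>{0..<int p}. \<Sum>y\<in>{0..<int p}. f x * cnj (f y) * addchar p (b * (x - y)))"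
    by (rule sum.swap)
  also have "\<dots> = (\<Sum>x\<in>{0..<int p}. \<Sum>y\<in>{0..<int p}. f x * cnj (f y) * (\<Sum>b\<in>{0..<int p}. addchar p (b * (x - y))))"
    unfolding sum_distrib_left by (rule sum.cong[OF refl]) (rule sum.swap)
  also have "\<dots> = (\<Sum>x\<in>{0..<int p}. \<Sum>y\<in>{0..<int p}. if y = x then of_nat p * (f x * cnj (f x)) else 0)"
    by (intro sum.cong) (auto simp: sum_addchar[OF p] dvd)
  also have "\<dots> = complex_of_real (real p * (\<Sum>x\<in>{0..<int p}. (norm (f x))\<^sup>2))"
    by (simp add: complex_norm_square sum_distrib_left del: of_real_power)
  finally show ?thesis
    by (simp only: of_real_eq_iff)
qed

text \<open>
  Expanding one factor \<open>f (x * r)\<close> into its Fourier series only shifts the frequency \<open>a\<close>,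
  which is why the claim is stated for all frequencies.
\<close>

lemma norm_twisted_sum_le:
  assumes p: "p > 0"
    and per: "\<And>y. f (y mod int p) = f y"
    and G: "\<And>a. norm (\<Sum>x\<in>{0..<int p}. g x * addchar p (a * x)) \<le> G"
    and L: "(\<Sum>h\<in>{0..<int p}. norm (fourier_coeff p f h)) \<le> L"
    and fin: "finite \<Gamma>"
  shows "norm (\<Sum>x\<in>{0..<int p}. g x * (\<Prod>r\<in>\<Gamma>. f (x * r)) * addchar p (a * x)) \<le> G * L ^ card \<Gamma>"
  using fin
proof (induction \<Gamma> arbitrary: a rule: finite_induct)
  case empty
  then show ?case using G by simp
next
  case (insert s \<Gamma>)
  let ?S = "\<lambda>a. \<Sum>x\<in>{0..<int p}. g x * (\<Prod>r\<in>\<Gamma>. f (x * r)) * addchar p (a * x)"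
  \<comment> \<open>The sign of the bound, needed to multiply by it below, is read off from the
    induction hypothesis.\<close>
  have "0 \<le> norm (?S 0)" by simp
  also have "\<dots> \<le> G * L ^ card \<Gamma>" by (rule insert.IH)
  finally have nonneg: "0 \<le> G * L ^ card \<Gamma>" .
  have "(\<Sum>x\<in>{0..<int p}. g x * (\<Prod>r\<in>insert s \<Gamma>. f (x * r)) * addchar p (a * x))
      = (\<Sum>x\<in>{0..<int p}. \<Sum>h\<in>{0..<int p}.
           fourier_coeff p f h * (g x * (\<Prod>r\<in>\<Gamma>. f (x * r)) * addchar p ((a + h * s) * x)))"
  proof (intro sum.cong refl)
    fix x
    have "g x * (\<Prod>r\<in>insert s \<Gamma>. f (x * r)) * addchar p (a * x)
       = f (x * s) * (g x * (\<Prod>r\<in>\<Gamma>. f (x * r)) * addchar p (a * x))"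
      using insert.hyps by simp
    also have "f (x * s) = (\<Sum>h\<in>{0..<int p}. fourier_coeff p f h * addchar p (h * (x * s)))"
      using p per by (rule fourier_inversion)
    also have "\<dots> * (g x * (\<Prod>r\<in>\<Gamma>. f (x * r)) * addchar p (a * x)) = (\<Sum>h\<in>{0..<int p}.
           fourier_coeff p f h * (g x * (\<Prod>r\<in>\<Gamma>. f (x * r)) * addchar p ((a + h * s) * x)))"
      by (simp add: sum_distrib_right sum_distrib_left distrib_left distrib_right addchar_add mult_ac)
    finally show "g x * (\<Prod>r\<in>insert s \<Gamma>. f (x * r)) * addchar p (a * x) = \<dots>" .
  qed
  also have "\<dots> = (\<Sum>h\<in>{0..<int p}. fourier_coeff p f h * ?S (a + h * s))"
    by (subst sum.swap) (simp add: sum_distrib_left)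
  finally have expand: "(\<Sum>x\<in>{0..<int p}. g x * (\<Prod>r\<in>insert s \<Gamma>. f (x * r)) * addchar p (a * x))
      = (\<Sum>h\<in>{0..<int p}. fourier_coeff p f h * ?S (a + h * s))" .
  have "norm (\<Sum>x\<in>{0..<int p}. g x * (\<Prod>r\<in>insert s \<Gamma>. f (x * r)) * addchar p (a * x))
      \<le> (\<Sum>h\<in>{0..<int p}. norm (fourier_coeff p f h * ?S (a + h * s)))"
    unfolding expand by (rule norm_sum)
  also have "\<dots> \<le> (\<Sum>h\<in>{0..<int p}. norm (fourier_coeff p f h) * (G * L ^ card \<Gamma>))"
    unfolding norm_mult by (intro sum_mono mult_left_mono insert.IH) simp
  also have "\<dots> \<le> L * (G * L ^ card \<Gamma>)"
    unfolding sum_distrib_right[symmetric] by (intro mult_right_mono L nonneg)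
  finally show ?case
    using insert.hyps by (simp add: mult_ac)
qed


section \<open>Gauss sums\<close>

lemma residues_eq_insert: "p > 0 \<Longrightarrow> {0..<int p} = insert 0 {1..<int p}"
  by auto

text \<open>Permits substituting \<open>a * x\<close> for \<open>x\<close> in sums over the nonzero
  residues. Primality gives injectivity, and finiteness then surjectivity.\<close>

lemma bij_betw_mult_mod_prime:
  assumes "Factorial_Ring.prime p" "\<not> int p dvd a"
  shows "bij_betw (\<lambda>x. a * x mod int p) {1..<int p} {1..<int p}"
proof -
  have prime: "Factorial_Ring.prime (int p)" using assms by simp
  then have pos: "int p > 0" by (rule prime_gt_0_int)
  have inj: "inj_on (\<lambda>x. a * x mod int p) {1..<int p}"
  proof (rule inj_onI)
    fix x y assume xy: "x \<in> {1..<int p}" "y \<in> {1..<int p}" and "a * x mod int p = a * y mod int p"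
    then have "int p dvd a * (x - y)"
      by (simp add: mod_eq_dvd_iff right_diff_distrib)
    then have "int p dvd x - y"
      using prime assms by (simp add: prime_dvd_mult_iff)
    then show "x = y"
      using xy by (auto simp flip: mod_eq_dvd_iff)
  qed
  have "a * x mod int p \<in> {1..<int p}" if "x \<in> {1..<int p}" for x
  proof -
    have "\<not> int p dvd x"
      using that by (auto dest: zdvd_imp_le)
    then have "a * x mod int p \<noteq> 0"
      using prime assms by (simp add: prime_dvd_mult_iff mod_eq_0_iff_dvd)
    moreover have "0 \<le> a * x mod int p" "a * x mod int p < int p"
      using pos by auto
    ultimately show ?thesis by simp
  qed
  then have "(\<lambda>x. a * x mod int p) ` {1..<int p} = {1..<int p}"
    using inj by (intro endo_inj_surj image_subsetI) auto
  with inj show ?thesis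
    by (simp add: bij_betw_def)
qed

lemma units_residue_ring_prime:
  assumes "Factorial_Ring.prime p"
  shows "carrier (units_of (residue_ring (int p))) = {1..<int p}"
proof -
  interpret residues_prime p "residue_ring (int p)"
    by unfold_locales (use assms prime_gt_1_nat in auto)
  show ?thesis
    by (auto simp: units_of_carrier res_prime_units_eq)
qed

section \<open>Values of a non-trivial multiplicative character\<close>

locale nontrivial_character =
  fixes p :: nat and chi :: "int \<Rightarrow> complex"
  assumes prime: "Factorial_Ring.prime p" and char: "nontrivial_mult_character p chi"
begin

lemma p_pos: "p > 0" and p_gt_1: "int p > 1"
  using prime prime_gt_0_nat prime_gt_1_int[of "int p"] by auto

lemma chi_0: "chi 0 = 0"
  using char by (simp add: nontrivial_mult_character_def)

lemma chi_mult_mod: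
  assumes "x \<in> {1..<int p}" "y \<in> {1..<int p}"
  shows "chi (x * y mod int p) = chi x * chi y"
  using char assms units_residue_ring_prime[OF prime]
  by (auto simp: nontrivial_mult_character_def hom_def units_of_mult ring_of_type_algebra_def
      residue_ring_def)

lemma chi_nonzero:
  assumes "x \<in> {1..<int p}"
  shows "chi x \<noteq> 0"
proof -
  have "chi x \<in> Units (ring_of_type_algebra :: complex ring)"
    using char assms units_residue_ring_prime[OF prime]
    by (auto simp: nontrivial_mult_character_def hom_def units_of_carrier)
  then show ?thesis
    by (auto simp: Units_def ring_of_type_algebra_def)
qed

lemma chi_1: "chi 1 = 1"
  using chi_mult_mod[of 1 1] chi_nonzero[of 1] p_gt_1 by simp

text \<open>The maximum \<open>M\<close> of \<^term>\<open>norm (chi x)\<close> satisfies \<open>M\<^sup>2 \<le> M\<close>, as squares are again values.\<close>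

lemma norm_chi_le_1:
  assumes "x \<in> {0..<int p}"
  shows "norm (chi x) \<le> 1"
proof (cases "x = 0")
  case False
  define M where "M = Max ((\<lambda>x. norm (chi x)) ` {1..<int p})"
  have fin: "finite ((\<lambda>x. norm (chi x)) ` {1..<int p})" and ne: "(\<lambda>x. norm (chi x)) ` {1..<int p} \<noteq> {}"
    using p_gt_1 by auto
  obtain y where y: "y \<in> {1..<int p}" "M = norm (chi y)"
    using Max_in[OF fin ne] by (auto simp: M_def)
  have "\<not> int p dvd y"
    using y by (auto dest: zdvd_imp_le)
  then have "y * y mod int p \<in> {1..<int p}"
    using bij_betw_mult_mod_prime[OF prime] y bij_betwE by blast
  then have "norm (chi (y * y mod int p)) \<le> M"
    unfolding M_def using fin by (intro Max_ge) auto
  then have "M * M \<le> M"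
    using y by (simp add: chi_mult_mod norm_mult)
  moreover have "M > 0"
    using y chi_nonzero by auto
  ultimately have "M \<le> 1" by simp
  moreover have "norm (chi x) \<le> M"
    unfolding M_def using fin assms False by (intro Max_ge) auto
  ultimately show ?thesis by simp
qed (simp add: chi_0)

lemma sum_chi_units: "(\<Sum>x\<in>{0..<int p}. chi x * F x) = (\<Sum>x\<in>{1..<int p}. chi x * F x)"
  using p_pos by (simp add: residues_eq_insert chi_0)

section \<open>Gauss sums of a fixed character\<close>

definition gauss_sum :: "int \<Rightarrow> complex" where
  "gauss_sum b = (\<Sum>x\<in>{0..<int p}. chi x * addchar p (b * x))"

text \<open>Substitute \<open>a * x\<close> for \<open>x\<close>; keeping \<open>chi a\<close>
  beside the sum at frequency \<open>b * a\<close> avoids inverses.\<close>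

lemma gauss_sum_mult:
  assumes "a \<in> {1..<int p}"
  shows "gauss_sum b = chi a * gauss_sum (b * a)"
proof -
  have "\<not> int p dvd a"
    using assms by (auto dest: zdvd_imp_le)
  then have bij: "bij_betw (\<lambda>x. a * x mod int p) {1..<int p} {1..<int p}"
    by (rule bij_betw_mult_mod_prime[OF prime])
  have "gauss_sum b = (\<Sum>x\<in>{1..<int p}. chi x * addchar p (b * x))"
    by (simp add: gauss_sum_def sum_chi_units)
  also have "\<dots> = (\<Sum>x\<in>{1..<int p}. chi (a * x mod int p) * addchar p (b * (a * x mod int p)))"
    by (rule sum.reindex_bij_betw[OF bij, symmetric])
  also have "\<dots> = (\<Sum>x\<in>{1..<int p}. chi a * (chi x * addchar p (b * a * x)))"
    using assms by (intro sum.cong) (simp_all add: chi_mult_mod addchar_mult_mod p_pos mult_ac)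
  finally show ?thesis
    by (simp add: gauss_sum_def sum_chi_units sum_distrib_left)
qed

lemma gauss_sum_mod: "gauss_sum (b mod int p) = gauss_sum b"
  unfolding gauss_sum_def
  by (intro sum.cong refl) (metis addchar_mult_mod mult.commute p_pos)

text \<open>Frequency \<open>0\<close> is fixed by that substitution, so the sum equals
  \<open>chi a\<close> times itself, and non-constancy provides \<open>a\<close> with
  \<open>chi a \<noteq> 1\<close>.\<close>

lemma gauss_sum_0: "gauss_sum 0 = 0"
proof -
  obtain a where a: "a \<in> {1..<int p}" "chi a \<noteq> 1"
    using char
    unfolding nontrivial_mult_character_def constant_on_def units_residue_ring_prime[OF prime] by blast
  then show ?thesis
    using gauss_sum_mult[of a 0] by simp
qed

text \<open>
  All the Gauss sums at nonzero frequencies have the same norm, so Parseval's identity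
  bounds each of them.
\<close>

lemma norm_gauss_sum_le: "norm (gauss_sum b) \<le> sqrt (real p)"
proof (cases "int p dvd b")
  case True
  then have "gauss_sum b = 0"
    by (metis dvd_imp_mod_0 gauss_sum_0 gauss_sum_mod)
  then show ?thesis by simp
next
  case False
  have card: "real (card {1..<int p}) = real p - 1"
    using p_pos by simp
  have "(real p - 1) * (norm (gauss_sum b))\<^sup>2 = (\<Sum>a\<in>{1..<int p}. (norm (gauss_sum b))\<^sup>2)"
    by (simp only: sum_constant card)
  also have "\<dots> \<le> (\<Sum>a\<in>{1..<int p}. (norm (gauss_sum (b * a mod int p)))\<^sup>2)"
  proof (intro sum_mono power_mono)
    fix a assume a: "a \<in> {1..<int p}"
    then have "norm (gauss_sum b) = norm (chi a) * norm (gauss_sum (b * a))"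
      by (subst gauss_sum_mult[OF a]) (simp add: norm_mult)
    also have "\<dots> \<le> norm (gauss_sum (b * a))"
      using a by (intro mult_left_le_one_le norm_chi_le_1) auto
    finally show "norm (gauss_sum b) \<le> norm (gauss_sum (b * a mod int p))"
      by (simp add: gauss_sum_mod)
  qed simp
  also have "\<dots> = (\<Sum>a\<in>{1..<int p}. (norm (gauss_sum a))\<^sup>2)"
    by (rule sum.reindex_bij_betw[OF bij_betw_mult_mod_prime[OF prime False]])
  also have "\<dots> \<le> (\<Sum>a\<in>{0..<int p}. (norm (gauss_sum a))\<^sup>2)"
    by (intro sum_mono2) auto
  also have "\<dots> = real p * (\<Sum>x\<in>{0..<int p}. (norm (chi x))\<^sup>2)"
    unfolding gauss_sum_def by (rule parseval[OF p_pos])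
  \<comment> \<open>Since \<open>chi 0 = 0\<close>, only \<open>p - 1\<close> terms remain; this
    factor cancels the number of frequencies averaged over.\<close>
  also have "\<dots> \<le> real p * (real p - 1)"
  proof (rule mult_left_mono)
    have "(\<Sum>x\<in>{0..<int p}. (norm (chi x))\<^sup>2) = (\<Sum>x\<in>{1..<int p}. (norm (chi x))\<^sup>2)"
      using p_pos by (simp add: residues_eq_insert chi_0)
    also have "\<dots> \<le> (\<Sum>x\<in>{1..<int p}. 1)"
      by (intro sum_mono power_le_one norm_chi_le_1) auto
    also have "\<dots> = real p - 1"
      by (simp only: sum_constant card mult_1_right)
    finally show "(\<Sum>x\<in>{0..<int p}. (norm (chi x))\<^sup>2) \<le> real p - 1" .
  qed simp
  finally have "(real p - 1) * (norm (gauss_sum b))\<^sup>2 \<le> (real p - 1) * real p"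
    by (simp add: mult.commute)
  then have "(norm (gauss_sum b))\<^sup>2 \<le> real p"
    using p_gt_1 by simp
  then show ?thesis
    by (rule real_le_rsqrt)
qed

end


section \<open>Bohr sets\<close>

lemma dist_int_le_iff: "dist_int \<theta> \<le> \<epsilon> \<longleftrightarrow> (\<exists>n::int. \<bar>\<theta> - of_int n\<bar> \<le> \<epsilon>)"
  unfolding dist_int_eq_round using round_diff_minimal[of \<theta>] order_trans by blast

lemma dist_int_add_of_int: "dist_int (\<theta> + of_int n) = dist_int \<theta>"
proof -
  have "\<theta> + of_int n + 1 / 2 = (\<theta> + 1 / 2) + of_int n" by simp
  then have "round (\<theta> + of_int n) = round \<theta> + n"
    unfolding round_def by (simp only: floor_add_int)
  then show ?thesis
    by (simp add: dist_int_eq_round)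
qed

lemma dist_int_mod:
  assumes "p > 0"
  shows "dist_int (of_int (y mod int p) / real p) = dist_int (of_int y / real p)"
proof -
  have y: "real_of_int y = real p * of_int (y div int p) + of_int (y mod int p)"
    by (metis mult_div_mod_eq of_int_add of_int_mult of_int_of_nat_eq)
  have "real_of_int y / real p = of_int (y mod int p) / real p + of_int (y div int p)"
    using assms by (subst y) (simp add: add_divide_distrib)
  then show ?thesis
    by (simp add: dist_int_add_of_int)
qed

text \<open>Defined on all integers, so that it can be evaluated at the unreduced products
  \<open>x * r\<close>.\<close>

definition near_zero :: "nat \<Rightarrow> real \<Rightarrow> int \<Rightarrow> complex" where
  "near_zero p \<epsilon> y = (if dist_int (of_int y / real p) \<le> \<epsilon> then 1 else 0)"

lemma near_zero_mod: "p > 0 \<Longrightarrow> near_zero p \<epsilon> (y mod int p) = near_zero p \<epsilon> y"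
  by (simp add: near_zero_def dist_int_mod)

text \<open>As \<open>m / p\<close> lies in \<open>[0, 1)\<close>, only the integers
  \<open>0\<close> and \<open>1\<close> compete for being nearest to it.\<close>

lemma dist_int_gt_iff:
  assumes "p > 0" "0 \<le> m" "m < int p"
  shows "dist_int (of_int m / real p) > \<epsilon> \<longleftrightarrow> of_int m > \<epsilon> * real p \<and> of_int m < real p - \<epsilon> * real p"
proof -
  have scale: "\<bar>of_int m / real p - of_int n\<bar> \<le> \<epsilon> \<longleftrightarrow> \<bar>of_int m - real p * of_int n\<bar> \<le> \<epsilon> * real p" for n
  proof -
    have "of_int m / real p - of_int n = (of_int m - real p * of_int n) / real p"
      using assms by (simp add: field_simps)
    then show ?thesis
      using assms by (simp add: abs_divide pos_divide_le_eq)
  qed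
  have "(\<exists>n::int. \<bar>of_int m - real p * of_int n\<bar> \<le> \<epsilon> * real p)
      \<longleftrightarrow> of_int m \<le> \<epsilon> * real p \<or> real p - of_int m \<le> \<epsilon> * real p" (is "?l \<longleftrightarrow> ?r")
  proof
    assume ?l
    then obtain n :: int where n: "\<bar>of_int m - real p * of_int n\<bar> \<le> \<epsilon> * real p" by blast
    show ?r
    proof (cases "n \<le> 0")
      case True
      then have "real p * of_int n \<le> 0"
        by (simp add: mult_nonneg_nonpos)
      then show ?thesis using n by linarith
    next
      case False
      then have "real p * 1 \<le> real p * of_int n"
        by (intro mult_left_mono) auto
      then show ?thesis using n by linarith
    qed
  next
    assume ?r
    then show ?l
    proof
      assume "of_int m \<le> \<epsilon> * real p"
      then show ?l using assms by (intro exI[of _ 0]) simp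
    next
      assume "real p - of_int m \<le> \<epsilon> * real p"
      then show ?l using assms by (intro exI[of _ 1]) simp
    qed
  qed
  then show ?thesis
    unfolding not_le[symmetric] dist_int_le_iff scale by auto
qed

text \<open>
  The complement of the support within one period is an interval of integers, so it is
  handled by a single geometric sum, whether or not \<open>\<epsilon>\<close> exceeds \<open>1/2\<close>.
\<close>

lemma norm_fourier_coeff_near_zero:
  assumes h: "h \<in> {1..<int p}" and \<epsilon>: "\<epsilon> > 0"
  shows "norm (fourier_coeff p (near_zero p \<epsilon>) h) \<le> 1 / of_int h + 1 / of_int (int p - h)"
proof -
  have p: "p > 0" using h by auto
  \<comment> \<open>\<open>a\<close> is the first integer strictly above
    \<open>\<epsilon> * p\<close>, and \<open>m < b\<close> means
    \<open>m < p - \<epsilon> * p\<close>. If \<open>\<epsilon>\<close> is at least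
    \<open>1/2\<close>, the interval is empty.\<close>
  define a b where "a = \<lfloor>\<epsilon> * real p\<rfloor> + 1" and "b = \<lceil>real p - \<epsilon> * real p\<rceil>"
  have pos: "\<epsilon> * real p > 0" using p \<epsilon> by simp
  have "a \<ge> 1" "b \<le> int p"
    using pos unfolding a_def b_def by (simp, linarith)
  then have sub: "{a..<b} \<subseteq> {0..<int p}" by auto
  have near: "near_zero p \<epsilon> m = 1 - of_bool (m \<in> {a..<b})" if "m \<in> {0..<int p}" for m
  proof -
    have "m \<in> {a..<b} \<longleftrightarrow> \<not> dist_int (of_int m / real p) \<le> \<epsilon>"
      using that dist_int_gt_iff[OF p, of m \<epsilon>] unfolding a_def b_def not_le
      by (auto simp: less_ceiling_iff floor_less_iff simp flip: int_one_le_iff_zero_less)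
        linarith+
    then show ?thesis
      by (simp add: near_zero_def)
  qed
  \<comment> \<open>Hence the full sum from the constant \<open>1\<close> vanishes, and only the
    interval sum contributes.\<close>
  have ndvd: "\<not> int p dvd - h"
    using h by (auto dest: zdvd_imp_le)
  let ?S = "\<Sum>m\<in>{a..<b}. addchar p (m * - h)"
  have "(\<Sum>m\<in>{0..<int p}. near_zero p \<epsilon> m * addchar p (- (h * m)))
      = (\<Sum>m\<in>{0..<int p}. addchar p (m * - h)) - (\<Sum>m\<in>{0..<int p}. if m \<in> {a..<b} then addchar p (m * - h) else 0)"
    unfolding sum_subtractf[symmetric] by (intro sum.cong) (auto simp: near mult.commute)
  also have "(\<Sum>m\<in>{0..<int p}. if m \<in> {a..<b} then addchar p (m * - h) else 0) = ?S"
    using sub by (subst sum.inter_restrict[symmetric]) (auto simp: Int_absorb1)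
  finally have coeff: "norm (fourier_coeff p (near_zero p \<epsilon>) h) = norm ?S / real p"
    using sum_addchar[OF p, of "- h"] ndvd by (simp add: fourier_coeff_def norm_divide)
  define u where "u = min (of_int h) (real p - of_int h)"
  have u: "u > 0"
    using h by (simp add: u_def)
  have "norm (1 - addchar p (- h)) = norm (cnj (1 - addchar p h))"
    by (simp add: cnj_addchar)
  also have "\<dots> = norm (1 - addchar p h)"
    by (rule complex_mod_cnj)
  finally have "norm (1 - addchar p (- h)) \<ge> 4 * u / real p"
    using norm_one_minus_addchar[of h p] h by (simp add: u_def)
  then have "4 * u / real p * norm ?S \<le> norm (1 - addchar p (- h)) * norm ?S"
    by (rule mult_right_mono) simp
  also have "\<dots> \<le> 2"
    by (rule norm_addchar_interval_sum_le)
  finally have "4 * (norm ?S / real p) * u \<le> 2" by (simp add: field_simps)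
  then have "norm ?S / real p \<le> 1 / u"
    using u by (simp add: pos_le_divide_eq)
  \<comment> \<open>Replacing the minimum by both terms leads to harmonic sums.\<close>
  also have "1 / u \<le> 1 / of_int h + 1 / of_int (int p - h)"
    using h by (auto simp: u_def min_def)
  finally show ?thesis
    by (simp add: coeff)
qed

section \<open>Total size of the Fourier coefficients\<close>

lemma harm_le: "n > 0 \<Longrightarrow> harm n \<le> 1 + ln (real n)"
proof -
  assume "n > 0"
  \<comment> \<open>\<open>harm n - ln n\<close> decreases from its value \<open>1\<close> at
    \<open>n = 1\<close>; the sequence is indexed by the predecessor.\<close>
  then have "harm (Suc (n - 1)) - ln (real (Suc (n - 1))) \<le> harm (Suc 0) - ln (real (Suc 0))"
    using decseqD[OF decseq_harm_diff_ln, of 0 "n - 1"] by simp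
  with \<open>n > 0\<close> show ?thesis by (simp add: harm_def)
qed

text \<open>Frequency \<open>0\<close> contributes at most \<open>1\<close>, the others two harmonic
  sums exchanged by reflecting \<open>h\<close> to \<open>p - h\<close>.\<close>

lemma sum_norm_fourier_coeff_near_zero:
  assumes p: "p \<ge> 3" and \<epsilon>: "\<epsilon> > 0"
  shows "(\<Sum>h\<in>{0..<int p}. norm (fourier_coeff p (near_zero p \<epsilon>) h)) \<le> 5 * ln (real p)"
proof -
  let ?c = "\<lambda>h. norm (fourier_coeff p (near_zero p \<epsilon>) h)"
  have "norm (\<Sum>m\<in>{0..<int p}. near_zero p \<epsilon> m) \<le> (\<Sum>m\<in>{0..<int p}. 1)"
    by (intro sum_norm_le) (simp add: near_zero_def)
  then have c0: "?c 0 \<le> 1"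
    using p by (simp add: fourier_coeff_def norm_divide)
  have harm: "(\<Sum>h\<in>{1..<int p}. 1 / real_of_int h) = harm (p - 1)"
    unfolding harm_def
    by (rule sum.reindex_bij_witness[of _ int nat]) (auto simp: inverse_eq_divide)
  have harm': "(\<Sum>h\<in>{1..<int p}. 1 / real_of_int (int p - h)) = (\<Sum>h\<in>{1..<int p}. 1 / real_of_int h)"
    by (rule sum.reindex_bij_witness[of _ "\<lambda>h. int p - h" "\<lambda>h. int p - h"]) auto
  have "(\<Sum>h\<in>{0..<int p}. ?c h) = ?c 0 + (\<Sum>h\<in>{1..<int p}. ?c h)"
    using p by (simp add: residues_eq_insert)
  also have "\<dots> \<le> 1 + (\<Sum>h\<in>{1..<int p}. 1 / of_int h + 1 / of_int (int p - h))"
    using c0 \<epsilon> by (intro add_mono sum_mono norm_fourier_coeff_near_zero)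
  also have "\<dots> = 1 + 2 * harm (p - 1)"
    by (simp only: sum.distrib harm harm')
  also have "\<dots> \<le> 1 + 2 * (1 + ln (real (p - 1)))"
    using harm_le[of "p - 1"] p by simp
  also have "\<dots> \<le> 3 + 2 * ln (real p)"
    using p by simp
  \<comment> \<open>From \<open>exp 1 \<le> 3 \<le> p\<close>; this absorbs the constant
    \<open>3\<close> into the logarithm.\<close>
  also have "1 \<le> ln (real p)"
    using p exp_le by (subst ln_ge_iff) auto
  then have "3 + 2 * ln (real p) \<le> 5 * ln (real p)" by simp
  finally show ?thesis by simp
qed

theorem theorem2p1:
  fixes d :: nat
  assumes "d \<ge> 1"
  shows "\<exists>C::real. \<exists>p\<^sub>0::nat. C > 0 \<and>
           (\<forall>p::nat. Factorial_Ring.prime p \<longrightarrow> p \<ge> p\<^sub>0 \<longrightarrow>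
             (\<forall>(\<Gamma>::int set) (\<epsilon>::real) (chi::int \<Rightarrow> complex).
                \<Gamma> \<subseteq> carrier (residue_ring (int p)) \<longrightarrow> card \<Gamma> = d \<longrightarrow> \<epsilon> > 0 \<longrightarrow>
                nontrivial_mult_character p chi \<longrightarrow>
                norm (\<Sum>x\<in>bohr_set p \<Gamma> \<epsilon>. chi x) \<le> C * sqrt (real p) * ln (real p) ^ d))"
proof (rule exI[of _ "5 ^ d"], rule exI[of _ 3], intro conjI allI impI)
  \<comment> \<open>The constant \<open>5 ^ d\<close> is the \<open>d\<close>-th power of the factor
    in \<open>L = 5 * ln p\<close>, and the threshold \<open>3\<close> ensures
    \<open>ln p \<ge> 1\<close>.\<close>
  fix p :: nat and \<Gamma> :: "int set" and \<epsilon> :: real and chi :: "int \<Rightarrow> complex"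
  assume prime: "Factorial_Ring.prime p" and p: "p \<ge> 3" and card: "card \<Gamma> = d" and \<epsilon>: "\<epsilon> > 0"
    and char: "nontrivial_mult_character p chi"
  interpret nontrivial_character p chi
    using prime char by unfold_locales
  \<comment> \<open>An infinite set has \<open>card\<close> equal to \<open>0\<close>, which
    \<open>d \<ge> 1\<close> excludes.\<close>
  have fin: "finite \<Gamma>"
    using card assms by (auto intro: card_ge_0_finite)
  have bohr: "bohr_set p \<Gamma> \<epsilon> = {x \<in> {0..<int p}. \<forall>r\<in>\<Gamma>. dist_int (of_int (x * r) / real p) \<le> \<epsilon>}"
    by (auto simp: bohr_set_def residue_ring_def)
  have ind: "(\<Prod>r\<in>\<Gamma>. near_zero p \<epsilon> (x * r))
      = (if \<forall>r\<in>\<Gamma>. dist_int (of_int (x * r) / real p) \<le> \<epsilon> then 1 else 0)" for x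
    using fin by (auto simp: near_zero_def simp del: of_int_mult)
  \<comment> \<open>The trivial twist by frequency \<open>0\<close> brings the sum into the shape of
    \<open>norm_twisted_sum_le\<close>.\<close>
  have "(\<Sum>x\<in>bohr_set p \<Gamma> \<epsilon>. chi x)
      = (\<Sum>x\<in>{0..<int p}. chi x * (\<Prod>r\<in>\<Gamma>. near_zero p \<epsilon> (x * r)) * addchar p (0 * x))"
    unfolding bohr ind by (subst sum.inter_filter) (auto intro!: sum.cong)
  moreover have "norm \<dots> \<le> sqrt (real p) * (5 * ln (real p)) ^ card \<Gamma>"
    by (rule norm_twisted_sum_le)
      (use p_pos near_zero_mod norm_gauss_sum_le sum_norm_fourier_coeff_near_zero[OF p \<epsilon>] fin
       in \<open>simp_all add: gauss_sum_def\<close>)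
  ultimately show "norm (\<Sum>x\<in>bohr_set p \<Gamma> \<epsilon>. chi x) \<le> 5 ^ d * sqrt (real p) * ln (real p) ^ d"
    by (simp add: card power_mult_distrib mult_ac)
qed simp

end
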